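(* Let $f\in C^{m+1}([\alpha_{\min},\alpha_{\max}])$ with $|f'(\alpha)|\ge a>0$ on $[\alpha_{\min},\alpha_{\max}]$. Let $\alpha$ be a random variable on $[\alpha_{\min},\alpha_{\max}]$ distributed by $c(\alpha)\,d\alpha$, where $c\in C^1([\alpha_{\min},\alpha_{\max}])$. Let $f_N=f_N^{\rm spline}$ be the natural, "not-a-knot", or clamped $m$-th order spline interpolant of $f$ on a uniform grid of $N$ points on $[\alpha_{\min},\alpha_{\max}]$, and let $p_f$ and $p_{f_N}$ be the probability density functions of $f(\alpha)$ and of $f_N(\alpha)$. Then, for any $1\le q<\infty$, $$\|p_f-p_{f_N}\|_q\le K N^{-m}\qquad\text{for all}\qquad N>\sqrt[m]{\frac{2C_{\rm spl}^{(1,m)}\|f^{(m+1)}\|_\infty}{a}}\,(\alpha_{\max}-\alpha_{\min}),$$ where $K$ depends only on $f$, $c$, $q$, and $|\alpha_{\max}-\alpha_{\min}|$, and $C_{\rm spl}^{(1,m)}$ is the spline interpolation constant defined in the context.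
   Context: $c\ge 0$ and $\int c(\alpha)\,d\alpha=1$ ($c$ is the PDF of the random input $\alpha$). $\|\cdot\|_q$ applied to densities is the norm of $L^q(\mathbb{R})$; $\|f^{(m+1)}\|_\infty$ is the sup norm on $[\alpha_{\min},\alpha_{\max}]$. Spline interpolants: given a grid $\alpha_{\min}=\alpha_1<\alpha_2<\dots<\alpha_N=\alpha_{\max}$, the $m$-th order spline interpolant of $f$ is a $C^{m-1}$ function that is a polynomial of degree at most $m$ on each grid interval, agrees with $f$ at every $\alpha_j$, and satisfies additional boundary conditions. For $m=3$ (cubic) these are: natural: the second derivative of the spline vanishes at $\alpha_1$ and $\alpha_N$; not-a-knot: the third derivative of the spline is continuous at $\alpha_2$ and $\alpha_{N-1}$; clamped: the first derivative of the spline equals $f'$ at $\alpha_1$ and $\alpha_N$. For other $m$, the boundary conditions are the corresponding ones of these types. The constants $C_{\rm spl}^{(j,m)}>0$ are those in the following spline error estimate from the literature (Hall–Meyer, Beatson), used as given: for $f\in C^{m+1}([\alpha_{\min},\alpha_{\max}])$ and its not-a-knot, clamped or natural $m$-th order spline interpolant, $$\big\|(f-f_N^{\rm spline})^{(j)}\big\|_{L^\infty[\alpha_{\min},\alpha_{\max}]}\le C_{\rm spl}^{(j,m)}\|f^{(m+1)}\|_\infty h_{\max}^{m+1-j},\qquad j=0,1,\dots,m-1,$$ where $h_{\max}=\max_{1<j\le N}|\alpha_j-\alpha_{j-1}|$ and $C_{\rm spl}^{(j,m)}$ depends only on the type of boundary condition, $m$ and $j$.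
   Formalization: With N points the spacing is L/(N-1), L=α_max-α_min, so with N_0 the stated threshold f_N may have a critical point and p_{f_N} fail to be in L^q when N_0<N≤N_0+1; for those N, p_{f_N}∈L^q is assumed. K is chosen for probability spaces on one underlying set type. *)

theory Defs
  imports "HOL-Probability.Probability"
begin

(* n-th derivative relative to S: only values on S matter, and the derivatives are
   one-sided at the endpoints of an interval. *)
definition deriv_on :: "real set \<Rightarrow> nat \<Rightarrow> (real \<Rightarrow> real) \<Rightarrow> real \<Rightarrow> real" where
  "deriv_on S n f = ((\<lambda>g x. vector_derivative g (at x within S)) ^^ n) f"

definition C_k_on :: "nat \<Rightarrow> real set \<Rightarrow> (real \<Rightarrow> real) \<Rightarrow> bool" where
  "C_k_on k S f \<longleftrightarrow>
     (\<forall>i<k. \<forall>x\<in>S. deriv_on S i f differentiable (at x within S)) \<and>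
     continuous_on S (deriv_on S k f)"

definition sup_norm_on :: "real set \<Rightarrow> (real \<Rightarrow> real) \<Rightarrow> real" where
  "sup_norm_on S g = (SUP x\<in>S. \<bar>g x\<bar>)"

(* Grids are indexed by 1, ..., N; values of t at other indices are irrelevant. *)
definition is_grid :: "real \<Rightarrow> real \<Rightarrow> nat \<Rightarrow> (nat \<Rightarrow> real) \<Rightarrow> bool" where
  "is_grid lo hi N t \<longleftrightarrow> 2 \<le> N \<and> t 1 = lo \<and> t N = hi \<and> strict_mono_on {1..N} t"

definition uniform_grid :: "real \<Rightarrow> real \<Rightarrow> nat \<Rightarrow> nat \<Rightarrow> real" where
  "uniform_grid lo hi N j = lo + (real j - 1) * (hi - lo) / (real N - 1)"

definition mesh_size :: "nat \<Rightarrow> (nat \<Rightarrow> real) \<Rightarrow> real" where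
  "mesh_size N t = Max ((\<lambda>j. \<bar>t j - t (j - 1)\<bar>) ` {2..N})"

datatype spline_bc = Natural | Not_A_Knot | Clamped

(* A degree-m spline leaves m - 1 degrees of freedom after interpolation, so l conditions
   are imposed at the left end and r at the right end, with l + r = m - 1.  For m = 3 we
   have l = r = 1 and these are the usual cubic conditions.  The natural conditions are
   those on derivatives of order m div 2 + 1 and higher: for odd m = 2k - 1 these are the
   orders k, ..., 2k - 2 at both ends. *)
fun boundary_conditions ::
  "spline_bc \<Rightarrow> nat \<Rightarrow> nat \<Rightarrow> nat \<Rightarrow> (real \<Rightarrow> real) \<Rightarrow> real \<Rightarrow> real \<Rightarrow> nat \<Rightarrow> (nat \<Rightarrow> real)
    \<Rightarrow> (real \<Rightarrow> real) \<Rightarrow> bool" where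
  "boundary_conditions Natural m l r f lo hi N t s \<longleftrightarrow>
     (\<forall>i\<in>{1..l}. deriv_on {lo..hi} (m div 2 + i) s lo = 0) \<and>
     (\<forall>i\<in>{1..r}. deriv_on {lo..hi} (m div 2 + i) s hi = 0)"
| "boundary_conditions Not_A_Knot m l r f lo hi N t s \<longleftrightarrow>
     (\<forall>j. 1 < j \<and> j < N \<and> (j \<le> l + 1 \<or> N \<le> j + r) \<longrightarrow>
        isCont (deriv_on {lo..hi} m s) (t j))"
| "boundary_conditions Clamped m l r f lo hi N t s \<longleftrightarrow>
     (\<forall>i\<in>{1..l}. deriv_on {lo..hi} i s lo = deriv_on {lo..hi} i f lo) \<and>
     (\<forall>i\<in>{1..r}. deriv_on {lo..hi} i s hi = deriv_on {lo..hi} i f hi)"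

definition spline_conditions ::
  "spline_bc \<Rightarrow> nat \<Rightarrow> nat \<Rightarrow> nat \<Rightarrow> (real \<Rightarrow> real) \<Rightarrow> real \<Rightarrow> real \<Rightarrow> nat \<Rightarrow> (nat \<Rightarrow> real)
    \<Rightarrow> (real \<Rightarrow> real) \<Rightarrow> bool" where
  "spline_conditions bc m l r f lo hi N t s \<longleftrightarrow>
     C_k_on (m - 1) {lo..hi} s \<and>
     (\<forall>j\<in>{1..<N}. \<exists>p :: real poly. degree p \<le> m \<and> (\<forall>x\<in>{t j..t (Suc j)}. s x = poly p x)) \<and>
     (\<forall>j\<in>{1..N}. s (t j) = f (t j)) \<and>
     boundary_conditions bc m l r f lo hi N t s"

(* s is THE spline interpolant on {lo..hi}: on grids with too few points the conditions may
   fail to determine s (e.g. not-a-knot cubics on 3 points), and then there is no such s.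
   For even m the number m - 1 of boundary conditions is odd and the extra one may be
   placed at either end. *)
definition is_spline_interpolant ::
  "spline_bc \<Rightarrow> nat \<Rightarrow> (real \<Rightarrow> real) \<Rightarrow> real \<Rightarrow> real \<Rightarrow> nat \<Rightarrow> (nat \<Rightarrow> real)
    \<Rightarrow> (real \<Rightarrow> real) \<Rightarrow> bool" where
  "is_spline_interpolant bc m f lo hi N t s \<longleftrightarrow>
     (\<exists>l r. l + r = m - 1 \<and> l \<le> r + 1 \<and> r \<le> l + 1 \<and>
        spline_conditions bc m l r f lo hi N t s \<and>
        (\<forall>s'. spline_conditions bc m l r f lo hi N t s' \<longrightarrow> (\<forall>x\<in>{lo..hi}. s' x = s x)))"

(* C is an admissible value of the constant with superscript (j,m) in the spline error
   estimate for f, over all grids.  A constant for which the estimate holds for all C^(m+1)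
   functions is in particular admissible for f.  The estimate is recorded for one f at a time
   because for natural cubic splines no constant serves all f (the order drops at an endpoint
   where f'' does not vanish). *)
definition spline_error_const ::
  "spline_bc \<Rightarrow> nat \<Rightarrow> nat \<Rightarrow> (real \<Rightarrow> real) \<Rightarrow> real \<Rightarrow> real \<Rightarrow> real \<Rightarrow> bool" where
  "spline_error_const bc j m f lo hi C \<longleftrightarrow>
     0 < C \<and>
     (\<forall>N t s. is_grid lo hi N t \<longrightarrow> is_spline_interpolant bc m f lo hi N t s \<longrightarrow>
        sup_norm_on {lo..hi} (deriv_on {lo..hi} j (\<lambda>x. f x - s x))
          \<le> C * sup_norm_on {lo..hi} (deriv_on {lo..hi} (m + 1) f) * mesh_size N t ^ (m + 1 - j))"

(* Nonnegativity is required because ennreal truncates negative values to 0. *)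
definition is_pdf :: "'a measure \<Rightarrow> ('a \<Rightarrow> real) \<Rightarrow> (real \<Rightarrow> real) \<Rightarrow> bool" where
  "is_pdf M Y p \<longleftrightarrow> (\<forall>y. 0 \<le> p y) \<and> distributed M lborel Y (\<lambda>y. ennreal (p y))"

definition in_Lq :: "real \<Rightarrow> (real \<Rightarrow> real) \<Rightarrow> bool" where
  "in_Lq q g \<longleftrightarrow> g \<in> borel_measurable lborel \<and> integrable lborel (\<lambda>y. \<bar>g y\<bar> powr q)"

(* Meaningful only together with in_Lq: the Bochner integral of a non-integrable function
   is 0. *)
definition Lq_norm :: "real \<Rightarrow> (real \<Rightarrow> real) \<Rightarrow> real" where
  "Lq_norm q g = (LINT y|lborel. \<bar>g y\<bar> powr q) powr (1 / q)"

end

theory Submission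
  imports Defs
begin

text \<open>
  If \<open>g\<close> is \<open>C\<^sup>1\<close> with non-vanishing derivative, the density of \<open>g(\<alpha>)\<close> is
  \<open>c(x) / |g'(x)|\<close> at \<open>y = g(x)\<close>.  The spline matches \<open>f\<close> at the endpoints and \<open>f'\<close> up to
  \<open>\<epsilon> = O(N\<^sup>-\<^sup>m) \<le> a/2\<close>, so both densities live on the same interval, the two preimages of \<open>y\<close> are
  \<open>O(\<epsilon>)\<close> apart, and the densities differ by \<open>O(\<epsilon>)\<close> uniformly; this bounds the \<open>L\<^sup>q\<close> norm.

  The constant may depend neither on \<open>a\<close> nor on the spline constant \<open>C\<close>.  For each type of
  boundary condition we therefore fix one admissible pair \<open>(a, C)\<close>, which handles all \<open>N\<close> above some
  \<open>N\<^sub>1\<close>.  For each of the finitely many smaller \<open>N\<close> the error takes only finitely many values, because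
  the interpolant, and hence its density up to null sets, is determined by \<open>N\<close>, the boundary
  condition type and the number of conditions at the left end.
  Since the mesh is \<open>(hi - lo) / (N - 1)\<close>, the threshold forces \<open>|f\<^sub>N'| \<ge> a/2\<close> only for \<open>N > N\<^sub>0 + 1\<close>.
\<close>

section \<open>Densities under monotone maps\<close>

lemma MVT_within_Icc:
  fixes g g' :: "real \<Rightarrow> real"
  assumes "lo < hi"
    and der: "\<And>x. x \<in> {lo..hi} \<Longrightarrow> (g has_real_derivative g' x) (at x within {lo..hi})"
    and "x \<in> {lo..hi}" "y \<in> {lo..hi}"
  obtains z where "z \<in> {lo..hi}" "g x - g y = g' z * (x - y)"
proof -
  have *: "\<exists>z\<in>{lo..hi}. g v - g u = g' z * (v - u)" if "lo \<le> u" "u < v" "v \<le> hi" for u v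
  proof -
    have "(g has_derivative (*) (g' z)) (at z within {u..v})" if "u \<le> z" "z \<le> v" for z
      using der[of z] that \<open>lo \<le> u\<close> \<open>v \<le> hi\<close>
      by (auto simp: has_field_derivative_def intro: has_derivative_subset)
    from mvt_simple[OF \<open>u < v\<close> this] show ?thesis
      using that by (meson atLeastAtMost_iff greaterThanLessThan_iff less_imp_le order.trans)
  qed
  consider "x < y" | "x = y" | "y < x" by linarith
  then have "\<exists>z\<in>{lo..hi}. g x - g y = g' z * (x - y)"
  proof cases
    case 1
    then obtain z where "z \<in> {lo..hi}" "g y - g x = g' z * (y - x)"
      using *[of x y] assms by auto
    then show ?thesis by (intro bexI[of _ z]) (auto simp: algebra_simps)
  qed (use * assms in auto)
  then show thesis using that by blast
qed

lemma derivative_lower_bound_imp_expanding: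
  fixes g g' :: "real \<Rightarrow> real"
  assumes "lo < hi"
    and "\<And>x. x \<in> {lo..hi} \<Longrightarrow> (g has_real_derivative g' x) (at x within {lo..hi})"
    and lb: "\<And>x. x \<in> {lo..hi} \<Longrightarrow> b \<le> \<bar>g' x\<bar>"
    and "x \<in> {lo..hi}" "y \<in> {lo..hi}"
  shows "b * \<bar>x - y\<bar> \<le> \<bar>g x - g y\<bar>"
proof -
  obtain z where z: "z \<in> {lo..hi}" "g x - g y = g' z * (x - y)"
    using MVT_within_Icc[of lo hi g g' x y] assms by blast
  show ?thesis
    unfolding z(2) abs_mult by (intro mult_right_mono lb z(1)) simp
qed

text \<open>The change-of-variables density of g(X), for X with density c on S and g injective there
  with derivative \<open>g'\<close>. Off the image \<open>inv_into\<close> is arbitrary, hence the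
  guard.\<close>

definition pushforward_density ::
  "(real \<Rightarrow> real) \<Rightarrow> (real \<Rightarrow> real) \<Rightarrow> (real \<Rightarrow> real) \<Rightarrow> real set \<Rightarrow> real \<Rightarrow> real" where
  "pushforward_density c g g' S y =
     (if y \<in> g ` S then c (inv_into S g y) / \<bar>g' (inv_into S g y)\<bar> else 0)"

section \<open>Laws of transformed random variables\<close>

lemma is_pdf_unique:
  assumes "is_pdf M X p" "is_pdf M' X' p'" "distr M lborel X = distr M' lborel X'"
  shows "AE y in lborel. p y = p' y"
proof -
  have "AE y in lborel. ennreal (p y) = ennreal (p' y)"
    by (rule sigma_finite_measure.density_unique[OF sigma_finite_lborel]) (use assms in \<open>auto simp: is_pdf_def distributed_def\<close>)
  then show ?thesis
    using assms by (auto simp: is_pdf_def)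
qed

lemma is_pdf_measurable: "is_pdf M X p \<Longrightarrow> p \<in> borel_measurable lborel"
  unfolding is_pdf_def by (intro distributed_real_measurable) auto

text \<open>Neither \<open>M\<close> nor \<open>X\<close> occurs in the integral, so the law of g(X)
  depends only on c and on g restricted to S. Both the comparison across probability spaces and the
  change of variables start from this form.\<close>

lemma emeasure_distr_image:
  assumes X: "is_pdf M X (\<lambda>x. indicator S x * c x)" and S: "S \<in> sets borel"
    and XS: "\<And>\<omega>. \<omega> \<in> space M \<Longrightarrow> X \<omega> \<in> S"
    and g: "continuous_on S g" and gX: "(\<lambda>\<omega>. g (X \<omega>)) \<in> borel_measurable M"
    and E: "E \<in> sets borel"
  shows "emeasure (distr M lborel (\<lambda>\<omega>. g (X \<omega>))) E =
     (\<integral>\<^sup>+x. ennreal (c x * indicator E (g x)) * indicator S x \<partial>lborel)"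
proof -
  \<comment> \<open>g need not be measurable off S. Its extension by 0 is Borel and agrees with g
    wherever X takes values.\<close>
  define G where "G x = (if x \<in> S then g x else 0)" for x
  have [measurable]: "G \<in> borel_measurable borel"
    unfolding G_def using g S by (intro borel_measurable_continuous_on_if) auto
  have D: "distributed M lborel X (\<lambda>x. ennreal (indicator S x * c x))"
    using X by (simp add: is_pdf_def)
  have nn: "0 \<le> indicator S x * c x" for x
    using X by (simp add: is_pdf_def)
  have "emeasure (distr M lborel (\<lambda>\<omega>. g (X \<omega>))) E = emeasure M ((\<lambda>\<omega>. g (X \<omega>)) -` E \<inter> space M)"
    using gX E by (simp add: emeasure_distr)
  also have "(\<lambda>\<omega>. g (X \<omega>)) -` E \<inter> space M = X -` (G -` E) \<inter> space M"
    using XS by (auto simp: G_def)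
  also have "emeasure M \<dots> = (\<integral>\<^sup>+x. ennreal (indicator S x * c x) * indicator (G -` E) x \<partial>lborel)"
    using E measurable_sets[of G borel borel E] by (intro distributed_emeasure[OF D]) auto
  also have "\<dots> = (\<integral>\<^sup>+x. ennreal (c x * indicator E (g x)) * indicator S x \<partial>lborel)"
    by (intro nn_integral_cong) (auto simp: indicator_def G_def)
  finally show ?thesis .
qed

text \<open>The integral form of the law sees g on S only, so the two laws coincide even when they
  come from different probability spaces.\<close>

lemma is_pdf_distr_cong:
  assumes "is_pdf M X (\<lambda>x. indicator S x * c x)" "is_pdf M' X' (\<lambda>x. indicator S x * c x)"
    and "S \<in> sets borel"
    and "\<And>\<omega>. \<omega> \<in> space M \<Longrightarrow> X \<omega> \<in> S" "\<And>\<omega>. \<omega> \<in> space M' \<Longrightarrow> X' \<omega> \<in> S"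
    and "continuous_on S g" and eq: "\<And>x. x \<in> S \<Longrightarrow> g x = g' x"
    and p: "is_pdf M (\<lambda>\<omega>. g (X \<omega>)) p" "is_pdf M' (\<lambda>\<omega>. g' (X' \<omega>)) p'"
  shows "AE y in lborel. p y = p' y"
proof (rule is_pdf_unique[OF p], rule measure_eqI)
  have g': "continuous_on S g'"
    using assms(6) eq continuous_on_cong by fastforce
  have m: "(\<lambda>\<omega>. g (X \<omega>)) \<in> borel_measurable M" "(\<lambda>\<omega>. g' (X' \<omega>)) \<in> borel_measurable M'"
    using p by (auto simp: is_pdf_def distributed_def)
  fix E assume "E \<in> sets (distr M lborel (\<lambda>\<omega>. g (X \<omega>)))"
  then have E: "E \<in> sets borel" by simp
  show "emeasure (distr M lborel (\<lambda>\<omega>. g (X \<omega>))) E = emeasure (distr M' lborel (\<lambda>\<omega>. g' (X' \<omega>))) E"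
    by (subst emeasure_distr_image[OF assms(1,3,4,6) m(1) E], assumption,
        subst emeasure_distr_image[OF assms(2,3,5) g' m(2) E], assumption,
        intro nn_integral_cong)
      (auto simp: indicator_def eq)
qed auto

section \<open>Change of variables on a compact interval\<close>

text \<open>Bounding |g'| from below, without fixing its sign, treats increasing and decreasing maps
  together. Since b > 0, the map expands distances up to a factor, so it is injective with
  continuous inverse.\<close>

locale monotone_change =
  fixes lo hi :: real and g g' c :: "real \<Rightarrow> real" and b :: real
  assumes lohi: "lo < hi"
    and der: "\<And>x. x \<in> {lo..hi} \<Longrightarrow> (g has_real_derivative g' x) (at x within {lo..hi})"
    and cont_g': "continuous_on {lo..hi} g'"
    and b: "0 < b" "\<And>x. x \<in> {lo..hi} \<Longrightarrow> b \<le> \<bar>g' x\<bar>"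
    and cont_c: "continuous_on {lo..hi} c"
    and c_nonneg: "\<And>x. x \<in> {lo..hi} \<Longrightarrow> 0 \<le> c x"
begin

abbreviation "S \<equiv> {lo..hi}"
abbreviation "ginv \<equiv> inv_into S g"
abbreviation "P \<equiv> pushforward_density c g g' S"

lemma cont_g: "continuous_on S g"
  using der by (meson DERIV_continuous continuous_on_eq_continuous_within)

lemma inj_g: "inj_on g S"
proof (rule inj_onI)
  fix x y assume xy: "x \<in> S" "y \<in> S" "g x = g y"
  have "b * \<bar>x - y\<bar> \<le> \<bar>g x - g y\<bar>"
    by (rule derivative_lower_bound_imp_expanding[OF lohi der b(2) xy(1,2)])
  then show "x = y"
    using b(1) xy by (simp add: mult_le_0_iff)
qed

lemma image_eq: "g ` S = closed_segment (g lo) (g hi)"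
  using continuous_injective_image_segment_1[of lo hi g] cont_g inj_g lohi
  by (simp add: closed_segment_eq_real_ivl)

lemma cont_P: "continuous_on (g ` S) (\<lambda>y. c (ginv y) / \<bar>g' (ginv y)\<bar>)"
proof -
  have inv: "continuous_on (g ` S) ginv"
    by (rule continuous_on_inv) (use cont_g inj_g in auto)
  have sub: "ginv ` (g ` S) \<subseteq> S"
    using inj_g by auto
  have "continuous_on (g ` S) (\<lambda>y. c (ginv y))" "continuous_on (g ` S) (\<lambda>y. g' (ginv y))"
    using continuous_on_compose2[OF cont_c inv sub] continuous_on_compose2[OF cont_g' inv sub] by auto
  moreover have "\<bar>g' (ginv y)\<bar> \<noteq> 0" if "y \<in> g ` S" for y
    using b sub that by force
  ultimately show ?thesis
    by (intro continuous_intros) auto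
qed

lemma image_measurable: "g ` S \<in> sets borel"
  unfolding image_eq by (simp add: borel_closed)

lemma P_measurable [measurable]: "P \<in> borel_measurable borel"
  unfolding pushforward_density_def
  by (intro borel_measurable_continuous_on_if image_measurable cont_P) auto

lemma P_nonneg: "0 \<le> P y"
  using c_nonneg inj_g by (auto simp: pushforward_density_def)

lemma P_at_image: "x \<in> S \<Longrightarrow> P (g x) = c x / \<bar>g' x\<bar>"
  using inj_g by (simp add: pushforward_density_def)

lemma P_outside: "y \<notin> g ` S \<Longrightarrow> P y = 0"
  by (simp add: pushforward_density_def)

lemma P_bounded: "\<exists>B. \<forall>y. P y \<le> B"
proof -
  have "compact ((\<lambda>y. c (ginv y) / \<bar>g' (ginv y)\<bar>) ` g ` S)"
    by (intro compact_continuous_image cont_P cont_g) simp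
  then obtain B where "\<forall>y\<in>g ` S. \<bar>c (ginv y) / \<bar>g' (ginv y)\<bar>\<bar> \<le> B"
    using compact_imp_bounded by (fastforce simp: bounded_iff)
  then show ?thesis
    by (intro exI[of _ "max B 0"]) (auto simp: pushforward_density_def le_max_iff_disj dest: abs_le_D1)
qed

text \<open>Substituting y = g x produces the Jacobian |g' x|, which cancels the denominator of
  \<open>P\<close> and leaves c x.\<close>

lemma density_P_eq:
  assumes E: "E \<in> sets borel"
  shows "(\<integral>\<^sup>+y. ennreal (P y) * indicator E y \<partial>lborel) =
    (\<integral>\<^sup>+x. ennreal (c x * indicator E (g x)) * indicator S x \<partial>lborel)"
proof -
  define F where "F y = P y * indicator E y" for y
  have F_nonneg: "0 \<le> F y" for y by (simp add: F_def P_nonneg)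
  obtain B where B: "P y \<le> B" for y using P_bounded by blast
  have B': "P y \<le> \<bar>B\<bar>" for y using B[of y] by linarith
  have [measurable]: "F \<in> borel_measurable borel"
    unfolding F_def using E by measurable
  \<comment> \<open>The substitution theorem asks for absolute integrability. It holds because
    \<open>P\<close> is bounded and the image is a compact interval.\<close>
  have "integrable lborel (\<lambda>y. indicator (g ` S) y * B)"
    by (rule integrable_mult_left)
      (auto simp: image_eq closed_segment_eq_real_ivl)
  then have "integrable lborel (\<lambda>y. indicator (g ` S) y *\<^sub>R F y)"
  proof (rule Bochner_Integration.integrable_bound)
    show "(\<lambda>y. indicator (g ` S) y *\<^sub>R F y) \<in> borel_measurable lborel"
      using image_measurable by measurable
    show "AE y in lborel. norm (indicator (g ` S) y *\<^sub>R F y) \<le> norm (indicator (g ` S) y * B)"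
      using B' P_nonneg by (auto simp: F_def indicator_def)
  qed
  then have absF: "F absolutely_integrable_on (g ` S)"
    by (simp add: set_integrable_def integrable_completion image_measurable)
  have *: "(\<lambda>x. \<bar>g' x\<bar> * F (g x)) absolutely_integrable_on S \<and>
        integral S (\<lambda>x. \<bar>g' x\<bar> * F (g x)) = integral (g ` S) F"
    using has_absolute_integral_change_of_variables_1'[OF _ der inj_g, of F "integral (g ` S) F"] absF
    by simp
  have eq: "\<bar>g' x\<bar> * F (g x) = c x * indicator E (g x)" if "x \<in> S" for x
    using b that P_at_image[OF that] by (force simp: F_def)
  have "((\<lambda>x. \<bar>g' x\<bar> * F (g x)) has_integral integral (g ` S) F) S"
    using * by (simp add: has_integral_iff set_lebesgue_integral_eq_integral(1))
  then have "((\<lambda>x. c x * indicator E (g x)) has_integral integral (g ` S) F) S"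
    by (rule has_integral_eq[rotated]) (use eq in auto)
  then have 1: "(\<integral>\<^sup>+x. ennreal (c x * indicator E (g x)) * indicator S x \<partial>lborel) = ennreal (integral (g ` S) F)"
    by (intro nn_integral_has_integral_lebesgue') (use c_nonneg in auto)
  have "(F has_integral integral (g ` S) F) (g ` S)"
    using absF by (simp add: set_lebesgue_integral_eq_integral(1) integrable_integral)
  then have "(\<integral>\<^sup>+y. ennreal (F y) * indicator (g ` S) y \<partial>lborel) = ennreal (integral (g ` S) F)"
    by (intro nn_integral_has_integral_lebesgue') (use F_nonneg in auto)
  moreover have "(\<integral>\<^sup>+y. ennreal (F y) * indicator (g ` S) y \<partial>lborel)
      = (\<integral>\<^sup>+y. ennreal (P y) * indicator E y \<partial>lborel)"
    by (intro nn_integral_cong) (auto simp: F_def indicator_def P_outside)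
  ultimately show ?thesis using 1 by simp
qed

text \<open>The law of g(X) and the measure with density \<open>P\<close> give every Borel set the
  same integral over S. So \<open>P\<close> is a density of g(X), and densities are unique almost
  everywhere.\<close>

lemma pdf_eq_P:
  assumes X: "is_pdf M X (\<lambda>x. indicator S x * c x)"
    and XS: "\<And>\<omega>. \<omega> \<in> space M \<Longrightarrow> X \<omega> \<in> S"
    and p: "is_pdf M (\<lambda>\<omega>. g (X \<omega>)) p"
  shows "AE y in lborel. p y = P y"
proof -
  have m: "(\<lambda>\<omega>. g (X \<omega>)) \<in> borel_measurable M"
    using p by (auto simp: is_pdf_def distributed_def)
  have "distr M lborel (\<lambda>\<omega>. g (X \<omega>)) = density lborel P"
  proof (rule measure_eqI)
    fix E assume "E \<in> sets (distr M lborel (\<lambda>\<omega>. g (X \<omega>)))"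
    then have E: "E \<in> sets borel" by simp
    then have "emeasure (density lborel P) E = (\<integral>\<^sup>+y. ennreal (P y) * indicator E y \<partial>lborel)"
      by (intro emeasure_density) auto
    then show "emeasure (distr M lborel (\<lambda>\<omega>. g (X \<omega>))) E = emeasure (density lborel P) E"
      using emeasure_distr_image[OF X _ XS cont_g m E] density_P_eq[OF E] by simp
  qed auto
  then have "is_pdf M (\<lambda>\<omega>. g (X \<omega>)) P"
    using m by (auto simp: is_pdf_def distributed_def P_nonneg)
  from is_pdf_unique[OF p this refl] show ?thesis .
qed

end

section \<open>Lebesgue norms\<close>

text \<open>For nonnegative numbers the difference is at most the larger one in absolute value, so
  its q-th power is dominated by the sum of the q-th powers.\<close>

lemma in_Lq_diff:
  assumes "0 < q" "\<And>y. 0 \<le> p y" "\<And>y. 0 \<le> p' y" "in_Lq q p" "in_Lq q p'"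
  shows "in_Lq q (\<lambda>y. p y - p' y)"
proof -
  have [measurable]: "p \<in> borel_measurable borel" "p' \<in> borel_measurable borel"
    using assms by (auto simp: in_Lq_def)
  have "\<bar>p y - p' y\<bar> powr q \<le> \<bar>p y\<bar> powr q + \<bar>p' y\<bar> powr q" for y
  proof (cases "p' y \<le> p y")
    case True
    then have "\<bar>p y - p' y\<bar> powr q \<le> \<bar>p y\<bar> powr q"
      using assms(1) assms(3)[of y] by (intro powr_mono2) auto
    then show ?thesis by (simp add: add_increasing2)
  next
    case False
    then have "\<bar>p y - p' y\<bar> powr q \<le> \<bar>p' y\<bar> powr q"
      using assms(1) assms(2)[of y] by (intro powr_mono2) auto
    then show ?thesis by (simp add: add_increasing)
  qed
  then have *: "norm (\<bar>p y - p' y\<bar> powr q) \<le> norm (\<bar>p y\<bar> powr q + \<bar>p' y\<bar> powr q)" for y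
    by simp
  have "integrable lborel (\<lambda>y. \<bar>p y\<bar> powr q + \<bar>p' y\<bar> powr q)"
    using assms(4,5) by (intro Bochner_Integration.integrable_add) (simp_all add: in_Lq_def)
  then have "integrable lborel (\<lambda>y. \<bar>p y - p' y\<bar> powr q)"
    by (rule Bochner_Integration.integrable_bound) (simp, intro AE_I2 *)
  then show ?thesis by (simp add: in_Lq_def)
qed

text \<open>The q-th power is dominated by B^q on an interval of length v - u. Membership is stated
  along with the bound because \<open>Lq_norm\<close> alone does not certify integrability.\<close>

lemma Lq_bound_of_bounded_support:
  assumes "0 < q" "0 \<le> B" "u \<le> v" and g: "g \<in> borel_measurable lborel"
    and bd: "AE y in lborel. \<bar>g y\<bar> \<le> B * indicator {u..v} y"
  shows "in_Lq q g" and "Lq_norm q g \<le> B * (v - u) powr (1 / q)"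
proof -
  have [measurable]: "g \<in> borel_measurable borel" using g by simp
  have int: "integrable lborel (\<lambda>y. B powr q * indicator {u..v} y)"
    by (intro integrable_mult_right integrable_real_indicator) (auto simp: emeasure_lborel_Icc_eq)
  have le: "AE y in lborel. \<bar>g y\<bar> powr q \<le> B powr q * indicator {u..v} y"
    using bd
  proof eventually_elim
    case (elim y)
    show ?case
    proof (cases "y \<in> {u..v}")
      case True
      then have "\<bar>g y\<bar> powr q \<le> B powr q"
        using elim assms(1) by (intro powr_mono2) simp_all
      then show ?thesis using True by simp
    next
      case False
      then show ?thesis using elim by simp
    qed
  qed
  have int': "integrable lborel (\<lambda>y. \<bar>g y\<bar> powr q)"
    by (rule Bochner_Integration.integrable_bound[OF int]) (measurable, use le in simp)
  then show "in_Lq q g" by (simp add: in_Lq_def)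
  have "(LINT y|lborel. \<bar>g y\<bar> powr q) \<le> (LINT y|lborel. B powr q * indicator {u..v} y)"
    by (rule integral_mono_AE[OF int' int le])
  also have "\<dots> = B powr q * (v - u)"
    using \<open>u \<le> v\<close> by simp
  finally have "Lq_norm q g \<le> (B powr q * (v - u)) powr (1 / q)"
    unfolding Lq_norm_def using \<open>0 < q\<close> by (intro powr_mono2) auto
  also have "\<dots> = B * (v - u) powr (1 / q)"
    using assms by (simp add: powr_mult powr_powr)
  finally show "Lq_norm q g \<le> B * (v - u) powr (1 / q)" .
qed

lemma Lq_norm_cong_AE:
  assumes "g \<in> borel_measurable lborel" "h \<in> borel_measurable lborel" "AE y in lborel. g y = h y"
  shows "Lq_norm q g = Lq_norm q h"
proof -
  have [measurable]: "g \<in> borel_measurable borel" "h \<in> borel_measurable borel"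
    using assms by auto
  have "(LINT y|lborel. \<bar>g y\<bar> powr q) = (LINT y|lborel. \<bar>h y\<bar> powr q)"
    by (rule integral_cong_AE) (use assms(3) in auto)
  then show ?thesis by (simp add: Lq_norm_def)
qed

section \<open>Splines on uniform grids\<close>

lemma deriv_on_deriv_on_1: "deriv_on S i (deriv_on S 1 f) = deriv_on S (Suc i) f"
  by (simp add: deriv_on_def funpow_Suc_right del: funpow.simps)

lemma C_k_on_deriv_on: "C_k_on (Suc k) S f \<Longrightarrow> C_k_on k S (deriv_on S 1 f)"
  unfolding C_k_on_def deriv_on_deriv_on_1 by auto

lemma C_k_on_derivative:
  assumes "C_k_on k S f" "1 \<le> k" "x \<in> S"
  shows "(f has_real_derivative deriv_on S 1 f x) (at x within S)"
proof -
  have "deriv_on S 0 f differentiable (at x within S)"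
    using assms unfolding C_k_on_def by (metis One_nat_def Suc_le_eq)
  then show ?thesis
    by (simp add: deriv_on_def vector_derivative_works has_real_derivative_iff_has_vector_derivative)
qed

lemma C_k_on_continuous:
  assumes "C_k_on k S f" "i \<le> k"
  shows "continuous_on S (deriv_on S i f)"
proof (cases "i = k")
  case False
  then have "\<forall>x\<in>S. deriv_on S i f differentiable (at x within S)"
    using assms by (simp add: C_k_on_def)
  then show ?thesis
    by (auto simp: continuous_on_eq_continuous_within intro: differentiable_imp_continuous_within)
qed (use assms in \<open>auto simp: C_k_on_def\<close>)

lemma continuous_on_Icc_bounded:
  fixes g :: "real \<Rightarrow> real"
  assumes "continuous_on {lo..hi} g"
  obtains B where "0 \<le> B" "\<And>x. x \<in> {lo..hi} \<Longrightarrow> \<bar>g x\<bar> \<le> B"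
proof -
  have "bounded (g ` {lo..hi})"
    by (intro compact_imp_bounded compact_continuous_image assms) simp
  then obtain B where "\<forall>x\<in>{lo..hi}. \<bar>g x\<bar> \<le> B" by (auto simp: bounded_iff)
  then show thesis
    by (intro that[of "max B 0"]) (auto simp: le_max_iff_disj)
qed

lemma C_k_on_lipschitz:
  assumes "C_k_on k {lo..hi} g" "1 \<le> k"
  obtains L where "0 \<le> L" "\<And>x y. x \<in> {lo..hi} \<Longrightarrow> y \<in> {lo..hi} \<Longrightarrow> \<bar>g x - g y\<bar> \<le> L * \<bar>x - y\<bar>"
proof -
  obtain L where L: "0 \<le> L" "\<And>x. x \<in> {lo..hi} \<Longrightarrow> \<bar>deriv_on {lo..hi} 1 g x\<bar> \<le> L"
    using continuous_on_Icc_bounded[OF C_k_on_continuous[OF assms]] by blast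
  have "\<bar>g x - g y\<bar> \<le> L * \<bar>x - y\<bar>" if "x \<in> {lo..hi}" "y \<in> {lo..hi}" for x y
    using field_differentiable_bound[of "{lo..hi}" g "deriv_on {lo..hi} 1 g" L x y]
      C_k_on_derivative[OF assms] L(2) that by simp
  then show thesis using that L(1) by blast
qed

section \<open>Mesh of the uniform grid and the first-derivative error\<close>

lemma uniform_grid_diff:
  "2 \<le> N \<Longrightarrow> uniform_grid lo hi N (Suc j) - uniform_grid lo hi N j = (hi - lo) / (real N - 1)"
  by (simp add: uniform_grid_def diff_divide_distrib[symmetric] left_diff_distrib[symmetric])

lemma is_grid_uniform_grid:
  assumes "lo < hi" "2 \<le> N"
  shows "is_grid lo hi N (uniform_grid lo hi N)"
proof -
  have "strict_mono_on {1..N} (uniform_grid lo hi N)"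
  proof (rule strict_mono_onI)
    fix i j :: nat
    assume "i < j"
    then show "uniform_grid lo hi N i < uniform_grid lo hi N j"
      unfolding uniform_grid_def using assms
      by (intro add_strict_left_mono divide_strict_right_mono mult_strict_right_mono) simp_all
  qed
  then show ?thesis
    using assms by (auto simp: is_grid_def uniform_grid_def)
qed

lemma mesh_size_uniform_grid:
  assumes "lo < hi" "2 \<le> N"
  shows "mesh_size N (uniform_grid lo hi N) = (hi - lo) / (real N - 1)"
proof -
  have "\<bar>uniform_grid lo hi N j - uniform_grid lo hi N (j - 1)\<bar> = (hi - lo) / (real N - 1)"
    if "j \<in> {2..N}" for j
    using uniform_grid_diff[of N lo hi "j - 1"] assms that by auto
  then have "(\<lambda>j. \<bar>uniform_grid lo hi N j - uniform_grid lo hi N (j - 1)\<bar>) ` {2..N}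
      = (\<lambda>j. (hi - lo) / (real N - 1)) ` {2..N}"
    by (intro image_cong) auto
  also have "\<dots> = {(hi - lo) / (real N - 1)}"
    using assms by (auto simp: image_constant_conv)
  finally have "(\<lambda>j. \<bar>uniform_grid lo hi N j - uniform_grid lo hi N (j - 1)\<bar>) ` {2..N}
      = {(hi - lo) / (real N - 1)}" .
  then show ?thesis by (simp add: mesh_size_def)
qed

text \<open>This is the assumed estimate for j = 1, passed from the sup norm of (f - s)' to a
  pointwise bound on f' - s'.\<close>

lemma spline_derivative_error:
  assumes "2 \<le> m" "lo < hi" "C_k_on (m + 1) {lo..hi} f"
    and C: "spline_error_const bc 1 m f lo hi C"
    and "2 \<le> N" and s: "is_spline_interpolant bc m f lo hi N (uniform_grid lo hi N) s"
    and x: "x \<in> {lo..hi}"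
  shows "\<bar>deriv_on {lo..hi} 1 f x - deriv_on {lo..hi} 1 s x\<bar>
    \<le> C * sup_norm_on {lo..hi} (deriv_on {lo..hi} (m + 1) f) * ((hi - lo) / (real N - 1)) ^ m"
proof -
  let ?S = "{lo..hi}"
  let ?d = "deriv_on ?S 1 (\<lambda>x. f x - s x)"
  have s_C: "C_k_on (m - 1) ?S s"
    using s by (auto simp: is_spline_interpolant_def spline_conditions_def)
  have eq: "?d x = deriv_on ?S 1 f x - deriv_on ?S 1 s x" if "x \<in> ?S" for x
  proof -
    have "((\<lambda>x. f x - s x) has_vector_derivative deriv_on ?S 1 f x - deriv_on ?S 1 s x) (at x within ?S)"
      using C_k_on_derivative[OF assms(3) _ that] C_k_on_derivative[OF s_C _ that] assms(1)
      by (intro has_vector_derivative_diff)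
        (auto simp: has_real_derivative_iff_has_vector_derivative)
    from vector_derivative_within_closed_interval[OF \<open>lo < hi\<close> that this]
    show ?thesis by (simp add: deriv_on_def)
  qed
  \<comment> \<open>A real supremum bounds its members only if they are bounded above; continuity on
    the compact interval ensures this.\<close>
  have "continuous_on ?S (\<lambda>x. deriv_on ?S 1 f x - deriv_on ?S 1 s x)"
    by (intro continuous_on_diff C_k_on_continuous[OF assms(3)] C_k_on_continuous[OF s_C])
      (use assms(1) in auto)
  then obtain B where
    "0 \<le> B" "\<And>x. x \<in> ?S \<Longrightarrow> \<bar>deriv_on ?S 1 f x - deriv_on ?S 1 s x\<bar> \<le> B"
    by (rule continuous_on_Icc_bounded) blast
  then have B: "\<bar>?d x\<bar> \<le> B" if "x \<in> ?S" for x
    using eq that by simp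
  have "\<bar>?d x\<bar> \<le> sup_norm_on ?S ?d"
    unfolding sup_norm_on_def by (intro cSUP_upper x bdd_aboveI2[of _ _ B] B)
  also have "\<dots> \<le> C * sup_norm_on ?S (deriv_on ?S (m + 1) f)
      * mesh_size N (uniform_grid lo hi N) ^ (m + 1 - 1)"
    using C s is_grid_uniform_grid[OF \<open>lo < hi\<close> \<open>2 \<le> N\<close>]
    unfolding spline_error_const_def by blast
  finally show ?thesis
    using eq[OF x] mesh_size_uniform_grid[OF \<open>lo < hi\<close> \<open>2 \<le> N\<close>] by simp
qed

section \<open>The density error\<close>

text \<open>Equal end values give both maps the same image, so y has a preimage under both or under
  neither. When both exist they are close, and the Lipschitz bounds on c and f' carry this over to
  the quotients.\<close>

lemma pushforward_density_diff:
  assumes F: "monotone_change lo hi f f' c a" and G: "monotone_change lo hi g g' c b"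
    and ends: "f lo = g lo" "f hi = g hi"
    and \<epsilon>: "\<And>x. x \<in> {lo..hi} \<Longrightarrow> \<bar>f' x - g' x\<bar> \<le> \<epsilon>"
    and Lc: "0 \<le> Lc" "\<And>x y. x \<in> {lo..hi} \<Longrightarrow> y \<in> {lo..hi} \<Longrightarrow> \<bar>c x - c y\<bar> \<le> Lc * \<bar>x - y\<bar>"
    and Lf: "0 \<le> Lf" "\<And>x y. x \<in> {lo..hi} \<Longrightarrow> y \<in> {lo..hi} \<Longrightarrow> \<bar>f' x - f' y\<bar> \<le> Lf * \<bar>x - y\<bar>"
    and B: "\<And>x. x \<in> {lo..hi} \<Longrightarrow> \<bar>c x\<bar> \<le> B"
  shows "\<bar>pushforward_density c f f' {lo..hi} y - pushforward_density c g g' {lo..hi} y\<bar>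
    \<le> (Lc * (hi - lo) / a / a + B * (1 + Lf * (hi - lo) / a) / (a * b)) * \<epsilon>
      * indicator (closed_segment (f lo) (f hi)) y"
proof -
  let ?S = "{lo..hi}"
  let ?Pf = "pushforward_density c f f' ?S" and ?Pg = "pushforward_density c g g' ?S"
  note f_der = monotone_change.der[OF F] and f_lb = monotone_change.b[OF F]
  note g_der = monotone_change.der[OF G] and g_lb = monotone_change.b[OF G]
  have lohi: "lo < hi" by (rule monotone_change.lohi[OF F])
  have image: "f ` ?S = closed_segment (f lo) (f hi)" "g ` ?S = closed_segment (f lo) (f hi)"
    using monotone_change.image_eq[OF F] monotone_change.image_eq[OF G] ends by auto
  show ?thesis
  proof (cases "y \<in> closed_segment (f lo) (f hi)")
    case False
    then show ?thesis
      using image by (simp add: pushforward_density_def)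
  next
    case True
    then have "y \<in> f ` ?S" "y \<in> g ` ?S"
      using image by auto
    then obtain x x' where x: "x \<in> ?S" "y = f x" and x': "x' \<in> ?S" "y = g x'"
      by blast
    have ab: "0 < a" "0 < b" "a \<le> \<bar>f' x\<bar>" "b \<le> \<bar>g' x'\<bar>"
      using f_lb g_lb x x' by auto
    define W where "W = hi - lo"
    have "0 < W" using lohi by (simp add: W_def)
    have "0 \<le> \<epsilon>" using \<epsilon>[OF x(1)] by linarith
    have "0 \<le> B" using B[OF x(1)] by linarith
    \<comment> \<open>f - g vanishes at \<open>lo\<close> and has slope at most \<epsilon>, so f x'
      lies within \<epsilon> W of g x' = y = f x. As f expands distances by at least a, the
      preimages are within \<epsilon> W / a.\<close>
    have "\<bar>(f x' - g x') - (f lo - g lo)\<bar> \<le> \<epsilon> * \<bar>x' - lo\<bar>"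
      using field_differentiable_bound[of ?S "\<lambda>x. f x - g x" "\<lambda>x. f' x - g' x" \<epsilon> x' lo]
        f_der g_der \<epsilon> x' lohi
      by (auto intro!: derivative_eq_intros)
    also have "\<dots> \<le> \<epsilon> * W"
      using x' \<open>0 \<le> \<epsilon>\<close> by (intro mult_left_mono) (auto simp: W_def)
    finally have "\<bar>f x' - f x\<bar> \<le> \<epsilon> * W"
      using ends x x' by simp
    then have "a * \<bar>x' - x\<bar> \<le> \<epsilon> * W"
      using derivative_lower_bound_imp_expanding[of lo hi f f' a x' x] lohi f_der f_lb x x' by force
    then have d: "\<bar>x - x'\<bar> \<le> \<epsilon> * W / a"
      using ab by (simp add: field_simps abs_minus_commute)
    have c: "\<bar>c x - c x'\<bar> \<le> Lc * (\<epsilon> * W / a)"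
      using Lc(2)[OF x(1) x'(1)] mult_left_mono[OF d Lc(1)] by linarith
    have "\<bar>f' x - f' x'\<bar> \<le> Lf * (\<epsilon> * W / a)"
      using Lf(2)[OF x(1) x'(1)] mult_left_mono[OF d Lf(1)] by linarith
    then have f: "\<bar>\<bar>g' x'\<bar> - \<bar>f' x\<bar>\<bar> \<le> \<epsilon> + Lf * (\<epsilon> * W / a)"
      using \<epsilon>[OF x'(1)] by linarith
    have "?Pf y - ?Pg y = c x / \<bar>f' x\<bar> - c x' / \<bar>g' x'\<bar>"
      using monotone_change.P_at_image[OF F x(1)] monotone_change.P_at_image[OF G x'(1)] x x' by simp
    \<comment> \<open>Change c first with the slope kept, then the slope with c kept, so that each
      term holds one small difference.\<close>
    also have "\<dots> = (c x - c x') / \<bar>f' x\<bar> + c x' * (\<bar>g' x'\<bar> - \<bar>f' x\<bar>) / (\<bar>f' x\<bar> * \<bar>g' x'\<bar>)"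
    proof -
      have "u / s - v / t = (u - v) / s + v * (t - s) / (s * t)" if "s \<noteq> 0" "t \<noteq> 0" for u v s t :: real
        using that by (simp add: field_simps)
      then show ?thesis using ab by simp
    qed
    finally have "\<bar>?Pf y - ?Pg y\<bar> \<le> \<bar>(c x - c x') / \<bar>f' x\<bar>\<bar>
        + \<bar>c x' * (\<bar>g' x'\<bar> - \<bar>f' x\<bar>) / (\<bar>f' x\<bar> * \<bar>g' x'\<bar>)\<bar>"
      by (simp only: abs_triangle_ineq)
    also have "\<dots> = \<bar>c x - c x'\<bar> / \<bar>f' x\<bar> + \<bar>c x'\<bar> * \<bar>\<bar>g' x'\<bar> - \<bar>f' x\<bar>\<bar> / (\<bar>f' x\<bar> * \<bar>g' x'\<bar>)"
      by (simp add: abs_mult)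
    also have "\<dots> \<le> Lc * (\<epsilon> * W / a) / a + B * (\<epsilon> + Lf * (\<epsilon> * W / a)) / (a * b)"
    proof (intro add_mono)
      show "\<bar>c x - c x'\<bar> / \<bar>f' x\<bar> \<le> Lc * (\<epsilon> * W / a) / a"
        by (rule frac_le) (use c ab in auto)
      have "\<bar>c x'\<bar> * \<bar>\<bar>g' x'\<bar> - \<bar>f' x\<bar>\<bar> \<le> B * (\<epsilon> + Lf * (\<epsilon> * W / a))"
        by (rule mult_mono) (use B[OF x'(1)] f \<open>0 \<le> B\<close> in auto)
      moreover have "a * b \<le> \<bar>f' x\<bar> * \<bar>g' x'\<bar>"
        by (rule mult_mono) (use ab in auto)
      moreover have "0 \<le> \<bar>c x'\<bar> * \<bar>\<bar>g' x'\<bar> - \<bar>f' x\<bar>\<bar>" by simp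
      ultimately show "\<bar>c x'\<bar> * \<bar>\<bar>g' x'\<bar> - \<bar>f' x\<bar>\<bar> / (\<bar>f' x\<bar> * \<bar>g' x'\<bar>)
          \<le> B * (\<epsilon> + Lf * (\<epsilon> * W / a)) / (a * b)"
        using ab by (intro frac_le mult_pos_pos) linarith+
    qed
    also have "\<dots> = (Lc * W / a / a + B * (1 + Lf * W / a) / (a * b)) * \<epsilon>"
      by (simp add: add_divide_distrib algebra_simps)
    finally show ?thesis using True by (simp only: W_def indicator_simps mult_1_right)
  qed
qed

section \<open>The setting, with slope and integrability bounds\<close>

text \<open>a and C are not parameters here: a constant chosen from these data alone cannot depend
  on them, nor on N or the boundary conditions.\<close>

locale density_approximation =
  fixes f c :: "real \<Rightarrow> real" and lo hi q :: real and m :: nat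
  assumes m: "2 \<le> m" and lohi: "lo < hi"
    and f: "C_k_on (m + 1) {lo..hi} f"
    and c: "C_k_on 1 {lo..hi} c" and c_nonneg: "\<And>x. x \<in> {lo..hi} \<Longrightarrow> 0 \<le> c x"
    and q: "1 \<le> q"
begin

abbreviation "S \<equiv> {lo..hi}"
abbreviation "f' \<equiv> deriv_on S 1 f"
abbreviation "F \<equiv> sup_norm_on S (deriv_on S (m + 1) f)"
abbreviation "N\<^sub>0 a C \<equiv> root m (2 * C * F / a) * (hi - lo)"

definition slope_bound :: "real \<Rightarrow> bool" where
  "slope_bound a \<longleftrightarrow> 0 < a \<and> (\<forall>x\<in>S. a \<le> \<bar>f' x\<bar>)"

definition input :: "'a measure \<Rightarrow> ('a \<Rightarrow> real) \<Rightarrow> bool" where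
  "input M \<alpha> \<longleftrightarrow> (\<forall>\<omega>\<in>space M. \<alpha> \<omega> \<in> S) \<and> is_pdf M \<alpha> (\<lambda>x. indicator S x * c x)"

definition densities ::
  "'a measure \<Rightarrow> ('a \<Rightarrow> real) \<Rightarrow> (real \<Rightarrow> real) \<Rightarrow> (real \<Rightarrow> real) \<Rightarrow> (real \<Rightarrow> real) \<Rightarrow> bool" where
  "densities M \<alpha> s p p' \<longleftrightarrow>
     input M \<alpha> \<and> is_pdf M (\<lambda>\<omega>. f (\<alpha> \<omega>)) p \<and> is_pdf M (\<lambda>\<omega>. s (\<alpha> \<omega>)) p'"

text \<open>The type of sample points occurs only in a bound variable, hence the
  \<open>itself\<close> argument. Neither a nor C appears, so a bound found with one admissible pair
  serves every other. Integrability is treated separately.\<close>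

definition error_le :: "'a itself \<Rightarrow> spline_bc \<Rightarrow> nat \<Rightarrow> real \<Rightarrow> bool" where
  "error_le _ bc N B \<longleftrightarrow> (\<forall>(M :: 'a measure) \<alpha> s p p'.
     is_spline_interpolant bc m f lo hi N (uniform_grid lo hi N) s \<longrightarrow> densities M \<alpha> s p p' \<longrightarrow>
     Lq_norm q (\<lambda>y. p y - p' y) \<le> B)"

lemma error_le_mono: "error_le TYPE('a) bc N B \<Longrightarrow> B \<le> B' \<Longrightarrow> error_le TYPE('a) bc N B'"
  unfolding error_le_def by (meson order.trans)

lemma F_nonneg: "0 \<le> F"
proof -
  obtain B where "0 \<le> B" "\<And>x. x \<in> S \<Longrightarrow> \<bar>deriv_on S (m + 1) f x\<bar> \<le> B"
    using continuous_on_Icc_bounded[OF C_k_on_continuous[OF f order_refl]] by blast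
  then have "\<bar>deriv_on S (m + 1) f lo\<bar> \<le> F"
    unfolding sup_norm_on_def using lohi
    by (intro cSUP_upper bdd_aboveI2[of _ _ B]) auto
  then show ?thesis by linarith
qed

lemma continuous_c: "continuous_on S c"
  using C_k_on_continuous[OF c, of 0] by (simp add: deriv_on_def)

lemma monotone_change_f: "slope_bound a \<Longrightarrow> monotone_change lo hi f f' c a"
  using lohi C_k_on_derivative[OF f] C_k_on_continuous[OF f, of 1] continuous_c c_nonneg
  by unfold_locales (simp_all add: slope_bound_def)

text \<open>A derivative error of at most half the slope of f leaves slope a / 2 to the spline, and
  m \<ge> 2 makes it C^1, so its density is also given by the change of variables.\<close>

lemma monotone_change_spline:
  assumes a: "slope_bound a"
    and s: "is_spline_interpolant bc m f lo hi N (uniform_grid lo hi N) s"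
    and err: "\<And>x. x \<in> S \<Longrightarrow> \<bar>f' x - deriv_on S 1 s x\<bar> \<le> a / 2"
  shows "monotone_change lo hi s (deriv_on S 1 s) c (a / 2)"
proof -
  have s_C: "C_k_on (m - 1) S s"
    using s by (auto simp: is_spline_interpolant_def spline_conditions_def)
  have "a / 2 \<le> \<bar>deriv_on S 1 s x\<bar>" if "x \<in> S" for x
  proof -
    have "a \<le> \<bar>f' x\<bar>" using a that by (simp add: slope_bound_def)
    with err[OF that] show ?thesis by linarith
  qed
  then show ?thesis
    using m lohi a C_k_on_derivative[OF s_C] C_k_on_continuous[OF s_C, of 1] continuous_c c_nonneg
    by unfold_locales (simp_all add: slope_bound_def)
qed

lemma in_Lq_pdf:
  assumes "monotone_change lo hi g g' c b" "input M \<alpha>" and p: "is_pdf M (\<lambda>\<omega>. g (\<alpha> \<omega>)) p"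
  shows "in_Lq q p"
proof -
  let ?P = "pushforward_density c g g' S"
  note G = assms(1)
  obtain B where B: "?P y \<le> B" for y using monotone_change.P_bounded[OF G] by blast
  define u v where "u = min (g lo) (g hi)" and "v = max (g lo) (g hi)"
  have supp: "g ` S = {u..v}"
    unfolding monotone_change.image_eq[OF G] closed_segment_eq_real_ivl u_def v_def by auto
  have "AE y in lborel. p y = ?P y"
    by (rule monotone_change.pdf_eq_P[OF G]) (use assms in \<open>auto simp: input_def\<close>)
  then have "AE y in lborel. \<bar>p y\<bar> \<le> \<bar>B\<bar> * indicator {u..v} y"
  proof eventually_elim
    case (elim y)
    have "\<bar>?P y\<bar> \<le> \<bar>B\<bar>" using B[of y] monotone_change.P_nonneg[OF G, of y] by linarith
    then show ?case
      using elim monotone_change.P_outside[OF G, of y] supp by (cases "y \<in> {u..v}") simp_all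
  qed
  then show ?thesis
    using q by (intro Lq_bound_of_bounded_support(1)[OF _ _ _ is_pdf_measurable[OF p]])
      (auto simp: u_def v_def)
qed

text \<open>The condition on N says that the m-th root of 2CF/a times the mesh is at most 1; its
  m-th power is the claim.\<close>

lemma spline_error_half_slope:
  assumes a: "slope_bound a" and C: "spline_error_const bc 1 m f lo hi C" and "2 \<le> N"
    and "N\<^sub>0 a C + 1 < real N"
  shows "C * F * ((hi - lo) / (real N - 1)) ^ m \<le> a / 2"
proof -
  have pos: "0 < a" "0 < C" "0 \<le> 2 * C * F / a"
    using a C F_nonneg by (auto simp: slope_bound_def spline_error_const_def)
  have "root m (2 * C * F / a) * ((hi - lo) / (real N - 1)) \<le> 1"
    using assms(3,4) by (simp add: field_simps)
  moreover have "0 \<le> root m (2 * C * F / a) * ((hi - lo) / (real N - 1))"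
    by (intro mult_nonneg_nonneg divide_nonneg_nonneg real_root_ge_zero pos)
      (use lohi \<open>2 \<le> N\<close> in auto)
  ultimately have "(root m (2 * C * F / a) * ((hi - lo) / (real N - 1))) ^ m \<le> 1 ^ m"
    by (rule power_mono)
  moreover have "root m (2 * C * F / a) ^ m = 2 * C * F / a"
    using m pos by simp
  ultimately have "2 * C * F / a * ((hi - lo) / (real N - 1)) ^ m \<le> 1"
    unfolding power_mult_distrib by simp
  then show ?thesis using pos(1) by (simp add: divide_le_eq mult.assoc)
qed

text \<open>Above \<open>N\<^sub>0 a C + 1\<close> the half-slope bound puts p' in L^q. Up to there
  the slope of the spline is not controlled, so membership of p' is assumed.\<close>

lemma in_Lq_density_diff:
  assumes a: "slope_bound a" and C: "spline_error_const bc 1 m f lo hi C" and N: "2 \<le> N"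
    and s: "is_spline_interpolant bc m f lo hi N (uniform_grid lo hi N) s"
    and p: "densities M \<alpha> s p p'"
    and small: "real N \<le> N\<^sub>0 a C + 1 \<longrightarrow> in_Lq q p'"
  shows "in_Lq q (\<lambda>y. p y - p' y)"
proof (rule in_Lq_diff)
  show "in_Lq q p"
    by (rule in_Lq_pdf[OF monotone_change_f[OF a]]) (use p in \<open>auto simp: densities_def\<close>)
  show "in_Lq q p'"
  proof (cases "real N \<le> N\<^sub>0 a C + 1")
    case False
    have "\<bar>f' x - deriv_on S 1 s x\<bar> \<le> a / 2" if "x \<in> S" for x
      using spline_derivative_error[OF m lohi f C N s that]
        spline_error_half_slope[OF a C N] False by linarith
    from monotone_change_spline[OF a s this] show ?thesis
      by (rule in_Lq_pdf) (use p in \<open>auto simp: densities_def\<close>)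
  qed (use small in blast)
qed (use q p in \<open>auto simp: densities_def is_pdf_def\<close>)

section \<open>A fixed number of grid points\<close>

lemma Lq_norm_bound_fixed_N:
  assumes "2 \<le> N"
  shows "\<exists>K. error_le TYPE('a) bc N K"
proof -
  \<comment> \<open>The split of the boundary conditions is coded by l alone, with r = m - 1 - l.
    Uniqueness of the interpolant for this split determines s on S.\<close>
  define uniq where "uniq l s \<longleftrightarrow>
      spline_conditions bc m l (m - 1 - l) f lo hi N (uniform_grid lo hi N) s \<and>
      (\<forall>s'. spline_conditions bc m l (m - 1 - l) f lo hi N (uniform_grid lo hi N) s' \<longrightarrow>
        (\<forall>x\<in>S. s' x = s x))" for l s
  define norms where
    "norms l = {Lq_norm q (\<lambda>y. p y - p' y) | (M :: 'a measure) \<alpha> s p p'.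
      uniq l s \<and> densities M \<alpha> s p p'}" for l
  have "finite (norms l)" for l
  proof -
    have eq: "Lq_norm q (\<lambda>y. p\<^sub>1 y - p\<^sub>1' y) = Lq_norm q (\<lambda>y. p\<^sub>2 y - p\<^sub>2' y)"
      if s: "uniq l s\<^sub>1" "uniq l s\<^sub>2"
        and p: "densities M\<^sub>1 \<alpha>\<^sub>1 s\<^sub>1 p\<^sub>1 p\<^sub>1'" "densities M\<^sub>2 \<alpha>\<^sub>2 s\<^sub>2 p\<^sub>2 p\<^sub>2'"
      for M\<^sub>1 M\<^sub>2 :: "'a measure" and \<alpha>\<^sub>1 \<alpha>\<^sub>2 s\<^sub>1 s\<^sub>2 p\<^sub>1 p\<^sub>2 p\<^sub>1' p\<^sub>2'
    proof -
      have *: "AE y in lborel. r\<^sub>1 y = r\<^sub>2 y"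
        if "is_pdf M\<^sub>1 (\<lambda>\<omega>. g\<^sub>1 (\<alpha>\<^sub>1 \<omega>)) r\<^sub>1" "is_pdf M\<^sub>2 (\<lambda>\<omega>. g\<^sub>2 (\<alpha>\<^sub>2 \<omega>)) r\<^sub>2"
          "\<And>x. x \<in> S \<Longrightarrow> g\<^sub>1 x = g\<^sub>2 x" "C_k_on k S g\<^sub>1" for g\<^sub>1 g\<^sub>2 r\<^sub>1 r\<^sub>2 k
      proof (rule is_pdf_distr_cong[where S = S and c = c, OF _ _ _ _ _ _ that(3) that(1,2)])
        show "continuous_on S g\<^sub>1"
          using C_k_on_continuous[OF that(4), of 0] by (simp add: deriv_on_def)
      qed (use p in \<open>auto simp: densities_def input_def\<close>)
      have "AE y in lborel. p\<^sub>1 y = p\<^sub>2 y"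
        by (rule *[OF _ _ refl f]) (use p in \<open>auto simp: densities_def\<close>)
      moreover have "AE y in lborel. p\<^sub>1' y = p\<^sub>2' y"
      proof (rule *)
        show "C_k_on (m - 1) S s\<^sub>1"
          using s(1) unfolding uniq_def spline_conditions_def by blast
        show "s\<^sub>1 x = s\<^sub>2 x" if "x \<in> S" for x
          using s that unfolding uniq_def by blast
      qed (use p in \<open>auto simp: densities_def\<close>)
      ultimately have "AE y in lborel. p\<^sub>1 y - p\<^sub>1' y = p\<^sub>2 y - p\<^sub>2' y"
        by eventually_elim simp
      then show ?thesis
        by (intro Lq_norm_cong_AE borel_measurable_diff)
          (use p is_pdf_measurable in \<open>auto simp: densities_def\<close>)
    qed
    show "finite (norms l)"
    proof (cases "norms l = {}")
      case False
      then obtain v where "v \<in> norms l" by blast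
      then obtain M\<^sub>1 :: "'a measure" and \<alpha>\<^sub>1 s\<^sub>1 p\<^sub>1 p\<^sub>1' where
        1: "v = Lq_norm q (\<lambda>y. p\<^sub>1 y - p\<^sub>1' y)" "uniq l s\<^sub>1" "densities M\<^sub>1 \<alpha>\<^sub>1 s\<^sub>1 p\<^sub>1 p\<^sub>1'"
        unfolding norms_def by blast
      \<comment> \<open>Any two choices of space, input, spline and densities give densities equal
        almost everywhere, hence one and the same norm.\<close>
      have "norms l \<subseteq> {v}"
      proof
        fix w assume "w \<in> norms l"
        then obtain M\<^sub>2 :: "'a measure" and \<alpha>\<^sub>2 s\<^sub>2 p\<^sub>2 p\<^sub>2' where
          2: "w = Lq_norm q (\<lambda>y. p\<^sub>2 y - p\<^sub>2' y)" "uniq l s\<^sub>2" "densities M\<^sub>2 \<alpha>\<^sub>2 s\<^sub>2 p\<^sub>2 p\<^sub>2'"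
          unfolding norms_def by blast
        show "w \<in> {v}" using eq[OF 2(2) 1(2) 2(3) 1(3)] 1(1) 2(1) by simp
      qed
      then show ?thesis by (rule finite_subset) simp
    qed simp
  qed
  then have "finite (\<Union>l\<le>m. norms l)" by simp
  \<comment> \<open>An empty union leaves \<open>Max\<close> unspecified, but then there is no v to
    bound.\<close>
  then have bdd: "v \<le> Max (\<Union>l\<le>m. norms l)" if "l \<le> m" "v \<in> norms l" for l v
    using that by (intro Max_ge) auto
  show ?thesis
    unfolding error_le_def
  proof (intro exI allI impI)
    fix M :: "'a measure" and \<alpha> s p p'
    assume s: "is_spline_interpolant bc m f lo hi N (uniform_grid lo hi N) s"
      and p: "densities M \<alpha> s p p'"
    from s obtain l r where "l + r = m - 1" and lr:
      "spline_conditions bc m l r f lo hi N (uniform_grid lo hi N) s \<and>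
      (\<forall>s'. spline_conditions bc m l r f lo hi N (uniform_grid lo hi N) s' \<longrightarrow>
        (\<forall>x\<in>S. s' x = s x))"
      unfolding is_spline_interpolant_def by blast
    then have "l \<le> m" "r = m - 1 - l" by auto
    with lr have "uniq l s" unfolding uniq_def by blast
    with p have "Lq_norm q (\<lambda>y. p y - p' y) \<in> norms l"
      unfolding norms_def by blast
    with \<open>l \<le> m\<close> show "Lq_norm q (\<lambda>y. p y - p' y) \<le> Max (\<Union>l\<le>m. norms l)"
      by (rule bdd)
  qed
qed

section \<open>Many grid points\<close>

lemma Lq_norm_bound_large_N:
  assumes a: "slope_bound a" and C: "spline_error_const bc 1 m f lo hi C"
  shows "\<exists>K N\<^sub>1. \<forall>N\<ge>N\<^sub>1. 2 \<le> N \<longrightarrow> error_le TYPE('a) bc N (K / real N ^ m)"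
proof -
  have Ca: "0 < a" "0 < C" using a C by (auto simp: slope_bound_def spline_error_const_def)
  obtain Lc where Lc: "0 \<le> Lc" "\<And>x y. x \<in> S \<Longrightarrow> y \<in> S \<Longrightarrow> \<bar>c x - c y\<bar> \<le> Lc * \<bar>x - y\<bar>"
    using C_k_on_lipschitz[OF c] by auto
  have "C_k_on m S f'" using C_k_on_deriv_on[of m S f] f by simp
  then obtain Lf where Lf: "0 \<le> Lf" "\<And>x y. x \<in> S \<Longrightarrow> y \<in> S \<Longrightarrow> \<bar>f' x - f' y\<bar> \<le> Lf * \<bar>x - y\<bar>"
    using C_k_on_lipschitz[of m lo hi f'] m by auto
  obtain B where B: "0 \<le> B" "\<And>x. x \<in> S \<Longrightarrow> \<bar>c x\<bar> \<le> B"
    using continuous_on_Icc_bounded[OF continuous_c] by blast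
  \<comment> \<open>The factor from \<open>pushforward_density_diff\<close> with b = a / 2.\<close>
  define D where "D = Lc * (hi - lo) / a / a + B * (1 + Lf * (hi - lo) / a) / (a * (a / 2))"
  have "0 \<le> D" using Lc Lf B Ca lohi by (auto simp: D_def)
  define u v where "u = min (f lo) (f hi)" and "v = max (f lo) (f hi)"
  have uv: "closed_segment (f lo) (f hi) = {u..v}"
    by (auto simp: closed_segment_eq_real_ivl u_def v_def)
  \<comment> \<open>The 2 comes from 1 / (N - 1) \<le> 2 / N, which turns the mesh into a multiple
    of 1 / N. The last factor is the L^q norm of the indicator of the common support.\<close>
  define K where "K = D * (C * F * (2 * (hi - lo)) ^ m) * (v - u) powr (1 / q)"
  obtain N\<^sub>1 :: nat where N\<^sub>1: "N\<^sub>0 a C + 1 < real N\<^sub>1"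
    using reals_Archimedean2 by blast
  have "Lq_norm q (\<lambda>y. p y - p' y) \<le> K / real N ^ m"
    if "N\<^sub>1 \<le> N" "2 \<le> N" and s: "is_spline_interpolant bc m f lo hi N (uniform_grid lo hi N) s"
      and p: "densities M \<alpha> s p p'" for N s p p' and M :: "'a measure" and \<alpha>
  proof -
    let ?s' = "deriv_on S 1 s"
    define \<epsilon> where "\<epsilon> = C * F * ((hi - lo) / (real N - 1)) ^ m"
    have "(hi - lo) / (real N - 1) \<le> 2 * (hi - lo) / real N"
    proof -
      have "1 / (real N - 1) \<le> 2 / real N"
        using \<open>2 \<le> N\<close> by (simp add: divide_simps)
      from mult_left_mono[OF this, of "hi - lo"] show ?thesis
        using lohi by (simp add: mult.commute)
    qed
    then have "((hi - lo) / (real N - 1)) ^ m \<le> (2 * (hi - lo) / real N) ^ m"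
      using \<open>2 \<le> N\<close> lohi by (intro power_mono) auto
    also have "\<dots> = (2 * (hi - lo)) ^ m / real N ^ m"
      by (rule power_divide)
    finally have \<epsilon>_le: "\<epsilon> \<le> C * F * (2 * (hi - lo)) ^ m / real N ^ m"
      unfolding \<epsilon>_def times_divide_eq_right[symmetric]
      by (intro mult_left_mono mult_nonneg_nonneg F_nonneg) (use Ca in auto)
    have "0 \<le> \<epsilon>"
      unfolding \<epsilon>_def using Ca F_nonneg lohi \<open>2 \<le> N\<close> by (intro mult_nonneg_nonneg) auto
    have err: "\<bar>f' x - ?s' x\<bar> \<le> \<epsilon>" if "x \<in> S" for x
      unfolding \<epsilon>_def by (rule spline_derivative_error[OF m lohi f C \<open>2 \<le> N\<close> s that])
    have "\<epsilon> \<le> a / 2"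
      unfolding \<epsilon>_def by (rule spline_error_half_slope[OF a C \<open>2 \<le> N\<close>]) (use N\<^sub>1 \<open>N\<^sub>1 \<le> N\<close> in linarith)
    note Fm = monotone_change_f[OF a]
    have Gm: "monotone_change lo hi s ?s' c (a / 2)"
      by (rule monotone_change_spline[OF a s]) (use err \<open>\<epsilon> \<le> a / 2\<close> in force)
    have nodes: "\<forall>j\<in>{1..N}. s (uniform_grid lo hi N j) = f (uniform_grid lo hi N j)"
      using s by (auto simp: is_spline_interpolant_def spline_conditions_def)
    have ends: "f lo = s lo" "f hi = s hi"
      using bspec[OF nodes, of 1] bspec[OF nodes, of N] \<open>2 \<le> N\<close>
        is_grid_uniform_grid[OF lohi \<open>2 \<le> N\<close>] by (auto simp: is_grid_def)
    have "AE y in lborel. p y = pushforward_density c f f' S y"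
      by (rule monotone_change.pdf_eq_P[OF Fm]) (use p in \<open>auto simp: densities_def input_def\<close>)
    moreover have "AE y in lborel. p' y = pushforward_density c s ?s' S y"
      by (rule monotone_change.pdf_eq_P[OF Gm]) (use p in \<open>auto simp: densities_def input_def\<close>)
    ultimately have "AE y in lborel. \<bar>p y - p' y\<bar> \<le> D * \<epsilon> * indicator {u..v} y"
    proof eventually_elim
      case (elim y)
      show ?case
        unfolding elim D_def uv[symmetric]
        by (rule pushforward_density_diff[OF Fm Gm ends err Lc Lf B(2)])
    qed
    moreover have "(\<lambda>y. p y - p' y) \<in> borel_measurable lborel"
      using p is_pdf_measurable by (intro borel_measurable_diff) (auto simp: densities_def)
    ultimately have "Lq_norm q (\<lambda>y. p y - p' y) \<le> D * \<epsilon> * (v - u) powr (1 / q)"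
      using q \<open>0 \<le> D\<close> \<open>0 \<le> \<epsilon>\<close>
      by (intro Lq_bound_of_bounded_support(2)) (auto simp: u_def v_def)
    also have "\<dots> \<le> D * (C * F * (2 * (hi - lo)) ^ m / real N ^ m) * (v - u) powr (1 / q)"
      by (intro mult_right_mono mult_left_mono \<epsilon>_le \<open>0 \<le> D\<close>) simp
    also have "\<dots> = K / real N ^ m" by (simp add: K_def)
    finally show ?thesis .
  qed
  then have "\<forall>N\<ge>N\<^sub>1. 2 \<le> N \<longrightarrow> error_le TYPE('a) bc N (K / real N ^ m)"
    by (simp add: error_le_def)
  then show ?thesis by blast
qed

section \<open>One constant for all a, C, N and boundary conditions\<close>

text \<open>K is chosen before a and C. If some admissible pair exists, it is fixed and yields K;
  otherwise the claim is vacuous.\<close>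

lemma Lq_norm_bound:
  "\<exists>K. \<forall>a C N. slope_bound a \<longrightarrow> spline_error_const bc 1 m f lo hi C \<longrightarrow> 2 \<le> N \<longrightarrow>
    error_le TYPE('a) bc N (K / real N ^ m)"
proof (cases "\<exists>a C. slope_bound a \<and> spline_error_const bc 1 m f lo hi C")
  case True
  then obtain a C where "slope_bound a" "spline_error_const bc 1 m f lo hi C" by blast
  from Lq_norm_bound_large_N[OF this, where 'a = 'a] obtain K N\<^sub>1 where
    K: "\<And>N. N\<^sub>1 \<le> N \<Longrightarrow> 2 \<le> N \<Longrightarrow> error_le TYPE('a) bc N (K / real N ^ m)"
    by blast
  obtain k where k: "\<And>N. 2 \<le> N \<Longrightarrow> error_le TYPE('a) bc N (k N)"
    using Lq_norm_bound_fixed_N[where bc = bc and 'a = 'a] by metis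
  \<comment> \<open>Multiplying by N^m brings the separate bounds for the finitely many N below
    \<open>N\<^sub>1\<close> into the form K / N^m.\<close>
  define K' where "K' = Max (insert K ((\<lambda>N. k N * real N ^ m) ` {..<N\<^sub>1}))"
  have "error_le TYPE('a) bc N (K' / real N ^ m)" if "2 \<le> N" for N
  proof (cases "N\<^sub>1 \<le> N")
    case True
    have "K / real N ^ m \<le> K' / real N ^ m"
      by (intro divide_right_mono) (auto simp: K'_def)
    with K[OF True that] show ?thesis by (rule error_le_mono)
  next
    case False
    have "k N = k N * real N ^ m / real N ^ m" using that by simp
    also have "\<dots> \<le> K' / real N ^ m"
      using False by (intro divide_right_mono) (auto simp: K'_def intro!: Max_ge)
    finally show ?thesis using k[OF that] error_le_mono by blast
  qed
  then show ?thesis by blast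
qed blast

lemma density_error:
  "\<exists>K. \<forall>(M :: 'a measure) \<alpha> bc a C N s p p'. slope_bound a \<longrightarrow> spline_error_const bc 1 m f lo hi C \<longrightarrow>
    2 \<le> N \<longrightarrow> is_spline_interpolant bc m f lo hi N (uniform_grid lo hi N) s \<longrightarrow>
    densities M \<alpha> s p p' \<longrightarrow> (real N \<le> N\<^sub>0 a C + 1 \<longrightarrow> in_Lq q p') \<longrightarrow>
    in_Lq q (\<lambda>y. p y - p' y) \<and> Lq_norm q (\<lambda>y. p y - p' y) \<le> K * real N powr (- real m)"
proof -
  obtain k where k: "\<And>bc a C N. slope_bound a \<Longrightarrow> spline_error_const bc 1 m f lo hi C \<Longrightarrow>
      2 \<le> N \<Longrightarrow> error_le TYPE('a) bc N (k bc / real N ^ m)"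
    using Lq_norm_bound[where 'a = 'a] by metis
  \<comment> \<open>The maximum over the three types removes the dependence on the boundary
    conditions.\<close>
  define K where "K = Max {k Natural, k Not_A_Knot, k Clamped}"
  have kK: "k bc \<le> K" for bc
    unfolding K_def by (cases bc) (auto intro!: Max_ge)
  show ?thesis
  proof (intro exI[of _ K] allI impI conjI)
    fix M :: "'a measure" and \<alpha> bc a C N s p p'
    assume a: "slope_bound a" and C: "spline_error_const bc 1 m f lo hi C" and N: "2 \<le> N"
      and s: "is_spline_interpolant bc m f lo hi N (uniform_grid lo hi N) s"
      and p: "densities M \<alpha> s p p'" and small: "real N \<le> N\<^sub>0 a C + 1 \<longrightarrow> in_Lq q p'"
    show "in_Lq q (\<lambda>y. p y - p' y)"
      by (rule in_Lq_density_diff[OF a C N s p small])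
    have "Lq_norm q (\<lambda>y. p y - p' y) \<le> k bc / real N ^ m"
      using k[OF a C N] s p by (simp add: error_le_def)
    also have "\<dots> \<le> K / real N ^ m"
      by (intro divide_right_mono kK) simp
    also have "\<dots> = K * real N powr (- real m)"
      using N by (simp add: powr_minus powr_realpow divide_inverse)
    finally show "Lq_norm q (\<lambda>y. p y - p' y) \<le> K * real N powr (- real m)" .
  qed
qed

end

theorem theorem4p7:
  fixes f c :: "real \<Rightarrow> real" and lo hi q :: real and m :: nat
  assumes "2 \<le> m" and "lo < hi"
    and "C_k_on (m + 1) {lo..hi} f"
    and "C_k_on 1 {lo..hi} c" and "\<forall>x\<in>{lo..hi}. 0 \<le> c x" and "(c has_integral 1) {lo..hi}"
    and "1 \<le> q"
  shows "\<exists>K. \<forall>(M :: 'a measure) \<alpha> bc a C N f\<^sub>N p_f p_f\<^sub>N.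
    let N\<^sub>0 = root m (2 * C * sup_norm_on {lo..hi} (deriv_on {lo..hi} (m + 1) f) / a) * (hi - lo) in
      0 < a \<longrightarrow> (\<forall>x\<in>{lo..hi}. a \<le> \<bar>deriv_on {lo..hi} 1 f x\<bar>) \<longrightarrow>
      prob_space M \<longrightarrow> (\<forall>\<omega>\<in>space M. \<alpha> \<omega> \<in> {lo..hi}) \<longrightarrow>
      is_pdf M \<alpha> (\<lambda>x. indicator {lo..hi} x * c x) \<longrightarrow>
      spline_error_const bc 1 m f lo hi C \<longrightarrow>
      2 \<le> N \<longrightarrow> is_spline_interpolant bc m f lo hi N (uniform_grid lo hi N) f\<^sub>N \<longrightarrow>
      is_pdf M (\<lambda>\<omega>. f (\<alpha> \<omega>)) p_f \<longrightarrow> is_pdf M (\<lambda>\<omega>. f\<^sub>N (\<alpha> \<omega>)) p_f\<^sub>N \<longrightarrow>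
      N\<^sub>0 < real N \<longrightarrow> (real N \<le> N\<^sub>0 + 1 \<longrightarrow> in_Lq q p_f\<^sub>N) \<longrightarrow>
        in_Lq q (\<lambda>y. p_f y - p_f\<^sub>N y) \<and>
        Lq_norm q (\<lambda>y. p_f y - p_f\<^sub>N y) \<le> K * real N powr (- real m)"
proof -
  have loc: "density_approximation f c lo hi q m"
    using assms by (simp add: density_approximation_def)
  show ?thesis
    using density_approximation.density_error[OF loc, where 'a = 'a]
    unfolding Let_def density_approximation.slope_bound_def[OF loc]
      density_approximation.densities_def[OF loc] density_approximation.input_def[OF loc]
    by (rule ex_forward) blast
qed

end
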